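(* Let $A\in\mathbb C^{N\times N}$ satisfy $\rho(A)<1$ and be diagonalisable with simple spectrum, let $B\in\mathbb C^{N\times p}$, and let $G_u\in\mathbb C^{p\times p}$ be the covariance of the controls. Let $\Sigma\succ0$ be the stationary covariance of the lifted recurrence $\Psi_{\ell+1}=A\Psi_\ell+Bu_\ell$ under white controls $u_\ell$ with covariance $G_u$, i.e. the unique solution of the discrete Lyapunov equation $$\Sigma=A\Sigma A^*+B\,G_u\,B^*.$$ If some orthonormal eigenbasis of $\Sigma$ consists of eigenvectors of $A$, then $A$ is normal; equivalently, $\kappa_2(V)=1$.
   Context: $\rho(A)$ is the spectral radius. $V$ is the eigenvector matrix of $A$ with columns normalised to unit $\ell_2$-norm, and $\kappa_2(V)=\|V\|_2\|V^{-1}\|_2$. $\Sigma\succ0$ (positive definiteness) is part of the hypotheses. *)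

theory Defs
  imports
    "HOL-Probability.Probability_Measure"
    "Jordan_Normal_Form.Spectral_Radius"
    "Jordan_Normal_Form.Schur_Decomposition"
    "Jordan_Normal_Form.Gauss_Jordan_Elimination"
begin

unbundle no vec_syntax

definition hermitian_mat :: "complex mat \<Rightarrow> bool" where
  "hermitian_mat S \<longleftrightarrow> square_mat S \<and> mat_adjoint S = S"

text \<open>Since \<open>x \<bullet>c y\<close> conjugates its second argument, \<open>(S *\<^sub>v x) \<bullet>c x\<close> is
  \<open>x\<^sup>* S x\<close>; it is real when \<open>S\<close> is Hermitian.\<close>

definition pos_semidef_mat :: "complex mat \<Rightarrow> bool" where
  "pos_semidef_mat S \<longleftrightarrow> hermitian_mat S \<and>
     (\<forall>x \<in> carrier_vec (dim_row S). 0 \<le> Re ((S *\<^sub>v x) \<bullet>c x))"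

definition pos_def_mat :: "complex mat \<Rightarrow> bool" where
  "pos_def_mat S \<longleftrightarrow> hermitian_mat S \<and>
     (\<forall>x \<in> carrier_vec (dim_row S). x \<noteq> 0\<^sub>v (dim_row S) \<longrightarrow> 0 < Re ((S *\<^sub>v x) \<bullet>c x))"

definition normal_mat :: "complex mat \<Rightarrow> bool" where
  "normal_mat A \<longleftrightarrow> square_mat A \<and> A * mat_adjoint A = mat_adjoint A * A"

definition diagonalisable :: "complex mat \<Rightarrow> bool" where
  "diagonalisable A \<longleftrightarrow> (\<exists>D. diagonal_mat D \<and> similar_mat A D)"

text \<open>Every eigenvalue has algebraic multiplicity one.\<close>

definition simple_spectrum :: "complex mat \<Rightarrow> bool" where
  "simple_spectrum A \<longleftrightarrow> (\<forall>\<mu> \<in> spectrum A. Polynomial.order \<mu> (char_poly A) = 1)"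

definition vec_norm2 :: "complex vec \<Rightarrow> real" where
  "vec_norm2 x = sqrt (\<Sum>i<dim_vec x. (cmod (x $ i))\<^sup>2)"

text \<open>The operator norm induced by the Euclidean norm, for matrices with at least one column.\<close>

definition mat_norm2 :: "complex mat \<Rightarrow> real" where
  "mat_norm2 A = (SUP x \<in> {x \<in> carrier_vec (dim_col A). vec_norm2 x = 1}. vec_norm2 (A *\<^sub>v x))"

text \<open>Only meaningful for invertible \<open>V\<close>, where \<open>mat_inverse V\<close> is \<open>Some\<close> of the inverse.\<close>

definition cond2 :: "complex mat \<Rightarrow> real" where
  "cond2 V = mat_norm2 V * mat_norm2 (the (mat_inverse V))"

definition unit_eigenvector_matrix :: "complex mat \<Rightarrow> complex mat \<Rightarrow> bool" where
  "unit_eigenvector_matrix A V \<longleftrightarrow>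
     V \<in> carrier_mat (dim_row A) (dim_row A) \<and> invertible_mat V \<and>
     (\<forall>j<dim_col V. vec_norm2 (col V j) = 1 \<and> (\<exists>\<mu>. eigenvector A (col V j) \<mu>))"

text \<open>\<open>dim_row S\<close> orthonormal vectors form a basis, so spanning need not be required.\<close>

definition orthonormal_eigenbasis :: "complex mat \<Rightarrow> complex vec list \<Rightarrow> bool" where
  "orthonormal_eigenbasis S vs \<longleftrightarrow>
     length vs = dim_row S \<and>
     (\<forall>i<length vs. \<exists>\<mu>. eigenvector S (vs ! i) \<mu>) \<and>
     (\<forall>i<length vs. \<forall>j<length vs. (vs ! i) \<bullet>c (vs ! j) = (if i = j then 1 else 0))"

definition lyapunov_solution ::
  "complex mat \<Rightarrow> complex mat \<Rightarrow> complex mat \<Rightarrow> complex mat \<Rightarrow> bool" where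
  "lyapunov_solution A B G S \<longleftrightarrow>
     S \<in> carrier_mat (dim_row A) (dim_row A) \<and>
     S = A * S * mat_adjoint A + B * G * mat_adjoint B"

definition square_integrable_vec :: "'w measure \<Rightarrow> nat \<Rightarrow> ('w \<Rightarrow> complex vec) \<Rightarrow> bool" where
  "square_integrable_vec M n X \<longleftrightarrow>
     (\<forall>\<omega> \<in> space M. X \<omega> \<in> carrier_vec n) \<and>
     (\<forall>i<n. (\<lambda>\<omega>. X \<omega> $ i) \<in> borel_measurable M \<and>
            integrable M (\<lambda>\<omega>. (cmod (X \<omega> $ i))\<^sup>2))"

definition mean_vec :: "'w measure \<Rightarrow> nat \<Rightarrow> ('w \<Rightarrow> complex vec) \<Rightarrow> complex vec" where
  "mean_vec M n X = vec n (\<lambda>i. integral\<^sup>L M (\<lambda>\<omega>. X \<omega> $ i))"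

text \<open>\<open>E[(X - E X) (Y - E Y)\<^sup>*]\<close>, entrywise.\<close>

definition cross_cov ::
  "'w measure \<Rightarrow> nat \<Rightarrow> nat \<Rightarrow> ('w \<Rightarrow> complex vec) \<Rightarrow> ('w \<Rightarrow> complex vec) \<Rightarrow> complex mat" where
  "cross_cov M n m X Y = mat n m (\<lambda>(i, j). integral\<^sup>L M
     (\<lambda>\<omega>. (X \<omega> $ i - mean_vec M n X $ i) * cnj (Y \<omega> $ j - mean_vec M m Y $ j)))"

definition white_controls ::
  "'w measure \<Rightarrow> nat \<Rightarrow> complex mat \<Rightarrow> (nat \<Rightarrow> 'w \<Rightarrow> complex vec) \<Rightarrow> bool" where
  "white_controls M p G u \<longleftrightarrow>
     (\<forall>l. square_integrable_vec M p (u l) \<and> mean_vec M p (u l) = 0\<^sub>v p) \<and>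
     (\<forall>k l. cross_cov M p p (u k) (u l) = (if k = l then G else 0\<^sub>m p p))"

text \<open>\<open>S\<close> is the time-independent covariance of a solution \<open>\<Psi>\<close> of
  \<open>\<Psi>\<^sub>l\<^sub>+\<^sub>1 = A \<Psi>\<^sub>l + B u\<^sub>l\<close>.  As usual for a causal recurrence, the initial state is
  uncorrelated with the controls.\<close>

definition stationary_covariance ::
  "'w measure \<Rightarrow> complex mat \<Rightarrow> complex mat \<Rightarrow> complex mat \<Rightarrow>
   (nat \<Rightarrow> 'w \<Rightarrow> complex vec) \<Rightarrow> (nat \<Rightarrow> 'w \<Rightarrow> complex vec) \<Rightarrow> complex mat \<Rightarrow> bool" where
  "stationary_covariance M A B G u \<Psi> S \<longleftrightarrow>
     prob_space M \<and> white_controls M (dim_col B) G u \<and>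
     square_integrable_vec M (dim_row A) (\<Psi> 0) \<and>
     (\<forall>l. cross_cov M (dim_row A) (dim_col B) (\<Psi> 0) (u l) = 0\<^sub>m (dim_row A) (dim_col B)) \<and>
     (\<forall>l. \<forall>\<omega> \<in> space M. \<Psi> (Suc l) \<omega> = A *\<^sub>v \<Psi> l \<omega> + B *\<^sub>v u l \<omega>) \<and>
     (\<forall>l. cross_cov M (dim_row A) (dim_row A) (\<Psi> l) (\<Psi> l) = S)"

end

theory Submission
  imports Defs
begin

text \<open>An orthonormal basis of eigenvectors diagonalises \<open>A\<close> unitarily, so \<open>A\<close> is normal.
  In eigenvector coordinates the difference \<open>F\<close> of two Lyapunov solutions satisfies
  \<open>F\<^sub>i\<^sub>j = \<lambda>\<^sub>i F\<^sub>i\<^sub>j cnj \<lambda>\<^sub>j\<close> with \<open>|\<lambda>\<^sub>i|, |\<lambda>\<^sub>j| < 1\<close>, which forces \<open>F = 0\<close>; a stationary covariance is a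
  Lyapunov solution by bilinearity of covariances.  If \<open>A\<close> is normal with simple spectrum, its
  eigenvectors are orthogonal, so \<open>V\<close> is unitary; conversely \<open>\<kappa>\<^sub>2(V) = 1\<close> makes \<open>V\<close> a multiple of
  an isometry, and the unit columns fix the multiple to one.\<close>

section \<open>Adjoints, Euclidean norm and operator norm\<close>

lemma index_mat_adjoint [simp]:
  "i < dim_col A \<Longrightarrow> j < dim_row A \<Longrightarrow> mat_adjoint A $$ (i, j) = conjugate (A $$ (j, i))"
  unfolding mat_adjoint_def by (simp add: mat_of_rows_index)

lemma dim_mat_adjoint [simp]:
  "dim_row (mat_adjoint A) = dim_col A" "dim_col (mat_adjoint A) = dim_row A"
  unfolding mat_adjoint_def by simp_all

lemma mat_adjoint_carrier [simp, intro]: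
  "A \<in> carrier_mat n m \<Longrightarrow> mat_adjoint A \<in> carrier_mat m n"
  by auto

lemma mat_adjoint_adjoint [simp]: "mat_adjoint (mat_adjoint A) = A"
  by (rule eq_matI) auto

lemma mat_adjoint_zero [simp]: "mat_adjoint (0\<^sub>m n m) = 0\<^sub>m m n"
  by (rule eq_matI) auto

lemma mat_adjoint_mat_diag: "mat_adjoint (mat_diag n d) = mat_diag n (\<lambda>i. conjugate (d i))"
  by (rule eq_matI) (auto simp: mat_diag_def)

lemma mat_adjoint_mult:
  assumes "A \<in> carrier_mat n m" "B \<in> carrier_mat m k"
  shows "mat_adjoint (A * B) = mat_adjoint B * mat_adjoint A"
  using assms
  by (intro eq_matI) (auto simp: scalar_prod_def sum_conjugate conjugate_dist_mul mult.commute)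

lemma cscalar_prod_mat_adjoint:
  fixes A :: "complex mat"
  assumes A: "A \<in> carrier_mat n m" and x: "x \<in> carrier_vec m" and y: "y \<in> carrier_vec n"
  shows "(A *\<^sub>v x) \<bullet>c y = x \<bullet>c (mat_adjoint A *\<^sub>v y)"
proof -
  have "(A *\<^sub>v x) \<bullet>c y = (\<Sum>i<n. \<Sum>j<m. A $$ (i, j) * x $ j * cnj (y $ i))"
    using assms by (simp add: scalar_prod_def atLeast0LessThan sum_distrib_right)
  also have "\<dots> = (\<Sum>j<m. \<Sum>i<n. A $$ (i, j) * x $ j * cnj (y $ i))"
    by (rule sum.swap)
  also have "\<dots> = x \<bullet>c (mat_adjoint A *\<^sub>v y)"
    using assms by (simp add: scalar_prod_def atLeast0LessThan sum_distrib_left mult_ac)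
  finally show ?thesis .
qed

text \<open>The Gram matrix of the columns. As \<open>\<bullet>c\<close> conjugates its second
  argument, the column of index \<open>j\<close> comes first.\<close>

lemma mat_adjoint_mult_self_index:
  assumes "V \<in> carrier_mat n m" "i < m" "j < m"
  shows "(mat_adjoint V * V) $$ (i, j) = col V j \<bullet>c col V i"
  using assms by (auto simp: scalar_prod_def mult.commute)

lemma power2_vec_norm2: "(vec_norm2 x)\<^sup>2 = Re (x \<bullet>c x)"
  unfolding vec_norm2_def
  by (simp add: sum_nonneg scalar_prod_def atLeast0LessThan complex_mult_cnj cmod_power2)

lemma cscalar_prod_self: "x \<bullet>c x = complex_of_real ((vec_norm2 x)\<^sup>2)"
  unfolding vec_norm2_def
  by (simp add: sum_nonneg scalar_prod_def atLeast0LessThan complex_mult_cnj cmod_power2)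

lemma vec_norm2_nonneg [simp]: "0 \<le> vec_norm2 x"
  unfolding vec_norm2_def by (simp add: sum_nonneg)

lemma vec_norm2_L2_set: "vec_norm2 x = L2_set (\<lambda>i. cmod (x $ i)) {..<dim_vec x}"
  by (simp add: vec_norm2_def L2_set_def)

lemma vec_norm2_eq_0: "vec_norm2 x = 0 \<Longrightarrow> x = 0\<^sub>v (dim_vec x)"
  by (intro eq_vecI) (simp_all add: vec_norm2_L2_set L2_set_eq_0_iff)

lemma vec_norm2_smult: "vec_norm2 (c \<cdot>\<^sub>v x) = cmod c * vec_norm2 x"
  by (simp add: vec_norm2_L2_set norm_mult L2_set_right_distrib cong: L2_set_cong_simp)

lemma vec_norm2_unit_vec [simp]: "i < n \<Longrightarrow> vec_norm2 (unit_vec n i) = 1"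
proof -
  assume "i < n"
  moreover have "(cmod (unit_vec n i $ j))\<^sup>2 = (if j = i then 1 else 0)" if "j < n" for j
    using that \<open>i < n\<close> by simp
  ultimately show ?thesis by (simp add: vec_norm2_def)
qed

text \<open>A real supremum can be used only over a bounded set. The coordinates of a unit vector
  have modulus at most one, so the sum of all entry moduli of \<open>A\<close> is a bound.\<close>

lemma bdd_above_mat_norm2:
  fixes A :: "complex mat"
  shows "bdd_above ((\<lambda>x. vec_norm2 (A *\<^sub>v x)) ` {x \<in> carrier_vec (dim_col A). vec_norm2 x = 1})"
proof (rule bdd_aboveI2)
  fix x assume "x \<in> {x \<in> carrier_vec (dim_col A). vec_norm2 x = 1}"
  then have x: "x \<in> carrier_vec (dim_col A)" "vec_norm2 x = 1" by auto
  have le1: "cmod (x $ j) \<le> 1" if "j < dim_col A" for j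
    using member_le_L2_set[of "{..<dim_vec x}" j "\<lambda>i. cmod (x $ i)"] that x
    by (simp add: vec_norm2_L2_set)
  have "vec_norm2 (A *\<^sub>v x) \<le> (\<Sum>i<dim_row A. cmod ((A *\<^sub>v x) $ i))"
    using L2_set_le_sum[of "{..<dim_row A}" "\<lambda>i. cmod ((A *\<^sub>v x) $ i)"]
    unfolding vec_norm2_L2_set dim_mult_mat_vec by simp
  also have "\<dots> \<le> (\<Sum>i<dim_row A. \<Sum>j<dim_col A. cmod (A $$ (i, j)))"
  proof (rule sum_mono)
    fix i assume "i \<in> {..<dim_row A}"
    then have "(A *\<^sub>v x) $ i = (\<Sum>j<dim_col A. A $$ (i, j) * x $ j)"
      using x by (simp add: scalar_prod_def atLeast0LessThan)
    moreover have "cmod (\<Sum>j<dim_col A. A $$ (i, j) * x $ j) \<le> (\<Sum>j<dim_col A. cmod (A $$ (i, j)))"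
      by (rule sum_norm_le) (simp add: norm_mult mult_left_le le1)
    ultimately show "cmod ((A *\<^sub>v x) $ i) \<le> (\<Sum>j<dim_col A. cmod (A $$ (i, j)))"
      by simp
  qed
  finally show "vec_norm2 (A *\<^sub>v x) \<le> (\<Sum>i<dim_row A. \<Sum>j<dim_col A. cmod (A $$ (i, j)))" .
qed

text \<open>A nonzero \<open>x\<close> is scaled to the unit sphere, where the supremum applies; the
  zero vector cannot be scaled and is treated apart.\<close>

lemma vec_norm2_mult_mat_vec_le:
  assumes x: "x \<in> carrier_vec (dim_col A)"
  shows "vec_norm2 (A *\<^sub>v x) \<le> mat_norm2 A * vec_norm2 x"
proof (cases "vec_norm2 x = 0")
  case True
  then have "x = 0\<^sub>v (dim_col A)" using vec_norm2_eq_0 x by force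
  then have "A *\<^sub>v x = 0\<^sub>v (dim_row A)" by auto
  then show ?thesis using True by (simp add: vec_norm2_def)
next
  case False
  let ?c = "complex_of_real (1 / vec_norm2 x)"
  have "vec_norm2 (A *\<^sub>v (?c \<cdot>\<^sub>v x)) \<le> mat_norm2 A"
    unfolding mat_norm2_def using False x
    by (intro cSUP_upper bdd_above_mat_norm2) (auto simp: vec_norm2_smult norm_divide)
  then have "vec_norm2 (A *\<^sub>v x) / vec_norm2 x \<le> mat_norm2 A"
    using x by (simp add: mult_mat_vec[of A "dim_row A" "dim_col A"] vec_norm2_smult norm_divide
        del: of_real_divide)
  then show ?thesis
    using False by (simp add: field_simps order_le_neq_trans[OF vec_norm2_nonneg])
qed

section \<open>Isometries and polarisation\<close>

lemma mat_norm2_isometry: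
  assumes V: "V \<in> carrier_mat n m" and m: "0 < m"
    and iso: "\<And>x. x \<in> carrier_vec m \<Longrightarrow> vec_norm2 (V *\<^sub>v x) = vec_norm2 x"
  shows "mat_norm2 V = 1"
proof -
  \<comment> \<open>Since \<open>0 < m\<close>, the unit sphere contains a unit vector, so the
    supremum is that of the constant 1 over a nonempty set.\<close>
  have "{x \<in> carrier_vec m. vec_norm2 x = 1} \<noteq> {}"
    using vec_norm2_unit_vec[OF m] by (metis (mono_tags, lifting) empty_iff mem_Collect_eq unit_vec_carrier)
  then show ?thesis
    using V iso by (simp add: mat_norm2_def cong: image_cong_simp)
qed

lemma vec_norm2_isometry:
  assumes V: "V \<in> carrier_mat n m" and unit: "mat_adjoint V * V = 1\<^sub>m m"
    and x: "x \<in> carrier_vec m"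
  shows "vec_norm2 (V *\<^sub>v x) = vec_norm2 x"
proof -
  have "(V *\<^sub>v x) \<bullet>c (V *\<^sub>v x) = x \<bullet>c (mat_adjoint V *\<^sub>v (V *\<^sub>v x))"
    using V x by (intro cscalar_prod_mat_adjoint) auto
  also have "mat_adjoint V *\<^sub>v (V *\<^sub>v x) = x"
    using V x unit assoc_mult_mat_vec[of "mat_adjoint V" m n V m x] by auto
  finally have "(vec_norm2 (V *\<^sub>v x))\<^sup>2 = (vec_norm2 x)\<^sup>2"
    by (simp add: power2_vec_norm2)
  then show ?thesis by simp
qed

text \<open>Half of the polarisation identity: norms determine the real part of the inner
  product.\<close>

lemma vec_norm2_add:
  assumes "x \<in> carrier_vec n" "y \<in> carrier_vec n"
  shows "(vec_norm2 (x + y))\<^sup>2 = (vec_norm2 x)\<^sup>2 + (vec_norm2 y)\<^sup>2 + 2 * Re (x \<bullet>c y)"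
proof -
  have "y \<bullet>c x = cnj (x \<bullet>c y)"
    using assms by (simp add: scalar_prod_def mult.commute)
  moreover have "(x + y) \<bullet>c (x + y) = x \<bullet>c x + y \<bullet>c y + (x \<bullet>c y + y \<bullet>c x)"
    using assms by (simp add: scalar_prod_def sum.distrib algebra_simps)
  ultimately show ?thesis by (simp add: power2_vec_norm2)
qed

text \<open>Polarisation gives the real part for every \<open>y\<close>. The imaginary part is the
  real part with \<open>\<i> \<cdot>\<^sub>v y\<close> in place of \<open>y\<close>, because the
  second argument is conjugated.\<close>

lemma isometry_cscalar_prod:
  assumes V: "V \<in> carrier_mat n m"
    and iso: "\<And>x. x \<in> carrier_vec m \<Longrightarrow> vec_norm2 (V *\<^sub>v x) = vec_norm2 x"
    and x: "x \<in> carrier_vec m" and y: "y \<in> carrier_vec m"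
  shows "(V *\<^sub>v x) \<bullet>c (V *\<^sub>v y) = x \<bullet>c y"
proof -
  have Re: "Re ((V *\<^sub>v x) \<bullet>c (V *\<^sub>v y)) = Re (x \<bullet>c y)" if y: "y \<in> carrier_vec m" for y
    using vec_norm2_add[of "V *\<^sub>v x" n "V *\<^sub>v y"] vec_norm2_add[OF x y] iso[OF x] iso[OF y]
      iso[of "x + y"] V x y by (auto simp: mult_add_distrib_mat_vec[OF V])
  have "Im ((V *\<^sub>v x) \<bullet>c (V *\<^sub>v y)) = Re ((V *\<^sub>v x) \<bullet>c (\<i> \<cdot>\<^sub>v (V *\<^sub>v y)))"
    using V by (simp add: conjugate_smult_vec)
  also have "\<dots> = Re ((V *\<^sub>v x) \<bullet>c (V *\<^sub>v (\<i> \<cdot>\<^sub>v y)))"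
    using V y by (simp add: mult_mat_vec)
  also have "\<dots> = Im (x \<bullet>c y)"
    using x y Re[of "\<i> \<cdot>\<^sub>v y"] by (simp add: conjugate_smult_vec)
  finally show ?thesis
    using Re[OF y] by (simp add: complex_eq_iff)
qed

lemma mult_mat_unit_vec:
  fixes V :: "'a :: semiring_1 mat"
  assumes "V \<in> carrier_mat n m" "j < m"
  shows "V *\<^sub>v unit_vec m j = col V j"
  using assms by (intro eq_vecI) auto

text \<open>The columns are the images of the standard unit vectors, whose inner products an
  isometry preserves.\<close>

lemma isometry_unitary:
  assumes V: "V \<in> carrier_mat n m"
    and iso: "\<And>x. x \<in> carrier_vec m \<Longrightarrow> vec_norm2 (V *\<^sub>v x) = vec_norm2 x"
  shows "mat_adjoint V * V = 1\<^sub>m m"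
proof (rule eq_matI)
  fix i j assume ij: "i < dim_row (1\<^sub>m m :: complex mat)" "j < dim_col (1\<^sub>m m :: complex mat)"
  have "(mat_adjoint V * V) $$ (i, j) = (V *\<^sub>v unit_vec m j) \<bullet>c (V *\<^sub>v unit_vec m i)"
    using ij mat_adjoint_mult_self_index[OF V] by (simp add: mult_mat_unit_vec[OF V])
  also have "\<dots> = unit_vec m j \<bullet>c (unit_vec m i :: complex vec)"
    using ij by (intro isometry_cscalar_prod[OF V iso]) auto
  also have "\<dots> = 1\<^sub>m m $$ (i, j)"
    using ij by (auto simp: scalar_prod_left_unit)
  finally show "(mat_adjoint V * V) $$ (i, j) = 1\<^sub>m m $$ (i, j)" .
qed (use V in auto)

section \<open>Covariances\<close>

text \<open>The condition that \<open>square_integrable_vec\<close> puts on one coordinate, isolated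
  so that closure under linear combinations is proved for scalar functions.\<close>

definition square_integrable :: "'w measure \<Rightarrow> ('w \<Rightarrow> complex) \<Rightarrow> bool" where
  "square_integrable M f \<longleftrightarrow> f \<in> borel_measurable M \<and> integrable M (\<lambda>\<omega>. (cmod (f \<omega>))\<^sup>2)"

lemma square_integrable_add:
  assumes f: "square_integrable M f" and g: "square_integrable M g"
  shows "square_integrable M (\<lambda>\<omega>. f \<omega> + g \<omega>)"
proof -
  have [measurable]: "f \<in> borel_measurable M" "g \<in> borel_measurable M"
    using f g by (auto simp: square_integrable_def)
  have "integrable M (\<lambda>\<omega>. (cmod (f \<omega> + g \<omega>))\<^sup>2)"
  proof (rule Bochner_Integration.integrable_bound)
    show "integrable M (\<lambda>\<omega>. 2 * (cmod (f \<omega>))\<^sup>2 + 2 * (cmod (g \<omega>))\<^sup>2)"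
      using f g by (auto simp: square_integrable_def)
    have "(cmod (a + b))\<^sup>2 \<le> 2 * (cmod a)\<^sup>2 + 2 * (cmod b)\<^sup>2" for a b
    proof -
      have "(cmod (a + b))\<^sup>2 \<le> (cmod a + cmod b)\<^sup>2"
        by (intro power_mono norm_triangle_ineq) simp
      also have "\<dots> \<le> 2 * (cmod a)\<^sup>2 + 2 * (cmod b)\<^sup>2"
        using sum_squares_bound[of "cmod a" "cmod b"] by (simp add: power2_sum)
      finally show ?thesis .
    qed
    then show "AE \<omega> in M. norm ((cmod (f \<omega> + g \<omega>))\<^sup>2)
        \<le> norm (2 * (cmod (f \<omega>))\<^sup>2 + 2 * (cmod (g \<omega>))\<^sup>2)"
      by simp
  qed measurable
  then show ?thesis by (simp add: square_integrable_def)
qed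

lemma square_integrable_cmult:
  "square_integrable M f \<Longrightarrow> square_integrable M (\<lambda>\<omega>. c * f \<omega>)"
  by (auto simp: square_integrable_def norm_mult power_mult_distrib)

lemma square_integrable_sum:
  "(\<And>i. i \<in> I \<Longrightarrow> square_integrable M (f i)) \<Longrightarrow> square_integrable M (\<lambda>\<omega>. \<Sum>i\<in>I. f i \<omega>)"
  by (induction I rule: infinite_finite_induct)
    (auto simp: square_integrable_add, auto simp: square_integrable_def)

text \<open>The integrand is dominated by means of \<open>|a b| \<le> |a|^2 + |b|^2\<close>. This
  makes every covariance integral below finite.\<close>

lemma square_integrable_mult_cnj:
  assumes f: "square_integrable M f" and g: "square_integrable M g"
  shows "integrable M (\<lambda>\<omega>. f \<omega> * cnj (g \<omega>))"
proof (rule Bochner_Integration.integrable_bound)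
  have [measurable]: "f \<in> borel_measurable M" "g \<in> borel_measurable M"
    using f g by (auto simp: square_integrable_def)
  have "(\<lambda>\<omega>. cnj (g \<omega>)) \<in> borel_measurable M"
    by (rule borel_measurable_continuous_on) (auto intro: continuous_intros)
  then show "(\<lambda>\<omega>. f \<omega> * cnj (g \<omega>)) \<in> borel_measurable M" by measurable
  show "integrable M (\<lambda>\<omega>. (cmod (f \<omega>))\<^sup>2 + (cmod (g \<omega>))\<^sup>2)"
    using f g by (auto simp: square_integrable_def)
  have "cmod (a * cnj b) \<le> (cmod a)\<^sup>2 + (cmod b)\<^sup>2" for a b
    using sum_squares_bound[of "cmod a" "cmod b"] mult_nonneg_nonneg[OF norm_ge_zero norm_ge_zero, of a b]
    unfolding norm_mult complex_mod_cnj by linarith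
  then show "AE \<omega> in M. norm (f \<omega> * cnj (g \<omega>)) \<le> norm ((cmod (f \<omega>))\<^sup>2 + (cmod (g \<omega>))\<^sup>2)"
    by simp
qed

lemma (in finite_measure) square_integrable_const: "square_integrable M (\<lambda>_. c)"
  by (simp add: square_integrable_def)

text \<open>On a finite measure space the constant 1 is square integrable, so \<open>f\<close> can
  be paired with it.\<close>

lemma (in finite_measure) square_integrable_integrable:
  "square_integrable M f \<Longrightarrow> integrable M f"
  using square_integrable_mult_cnj[OF _ square_integrable_const[of 1], of f] by simp

lemma (in finite_measure) square_integrable_diff_const:
  "square_integrable M f \<Longrightarrow> square_integrable M (\<lambda>\<omega>. f \<omega> - c)"
  using square_integrable_add[OF _ square_integrable_const[of "- c"], of f] by simp

lemma square_integrable_vecD: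
  "square_integrable_vec M n X \<Longrightarrow> i < n \<Longrightarrow> square_integrable M (\<lambda>\<omega>. X \<omega> $ i)"
  by (simp add: square_integrable_vec_def square_integrable_def)

lemma affine_index:
  fixes A B :: "complex mat"
  assumes "A \<in> carrier_mat n m" "B \<in> carrier_mat n p" "x \<in> carrier_vec m" "y \<in> carrier_vec p" "i < n"
  shows "(A *\<^sub>v x + B *\<^sub>v y) $ i = (\<Sum>k<m. A $$ (i, k) * x $ k) + (\<Sum>k<p. B $$ (i, k) * y $ k)"
  using assms by (simp add: scalar_prod_def atLeast0LessThan)

lemma square_integrable_vec_affine:
  assumes A: "A \<in> carrier_mat n m" and B: "B \<in> carrier_mat n p"
    and X: "square_integrable_vec M m X" and Y: "square_integrable_vec M p Y"
    and Z: "\<And>\<omega>. \<omega> \<in> space M \<Longrightarrow> Z \<omega> = A *\<^sub>v X \<omega> + B *\<^sub>v Y \<omega>"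
  shows "square_integrable_vec M n Z"
  unfolding square_integrable_vec_def
proof (intro conjI ballI allI impI)
  fix \<omega> assume "\<omega> \<in> space M"
  then show "Z \<omega> \<in> carrier_vec n"
    using A B X Y Z by (auto simp: square_integrable_vec_def
        intro!: add_carrier_vec mult_mat_vec_carrier)
next
  fix i assume i: "i < n"
  have eq: "Z \<omega> $ i = (\<Sum>k<m. A $$ (i, k) * X \<omega> $ k) + (\<Sum>k<p. B $$ (i, k) * Y \<omega> $ k)"
    if "\<omega> \<in> space M" for \<omega>
    using X Y that i Z by (simp add: affine_index[OF A B] square_integrable_vec_def)
  have "square_integrable M (\<lambda>\<omega>. (\<Sum>k<m. A $$ (i, k) * X \<omega> $ k) + (\<Sum>k<p. B $$ (i, k) * Y \<omega> $ k))"
    using X Y by (intro square_integrable_add square_integrable_sum square_integrable_cmult)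
      (auto intro: square_integrable_vecD)
  then show "(\<lambda>\<omega>. Z \<omega> $ i) \<in> borel_measurable M" "integrable M (\<lambda>\<omega>. (cmod (Z \<omega> $ i))\<^sup>2)"
    by (simp_all add: square_integrable_def eq cong: measurable_cong Bochner_Integration.integrable_cong)
qed

section \<open>Cross-covariance matrices and affine recurrences\<close>

lemma cross_cov_carrier [simp]: "cross_cov M n m X Y \<in> carrier_mat n m"
  by (simp add: cross_cov_def)

text \<open>Conjugate symmetry transfers linearity from the first argument to the second.\<close>

lemma mat_adjoint_cross_cov: "mat_adjoint (cross_cov M n m X Y) = cross_cov M m n Y X"
proof (rule eq_matI)
  fix i j assume "i < dim_row (cross_cov M m n Y X)" "j < dim_col (cross_cov M m n Y X)"
  then have ij: "i < m" "j < n" by (auto simp: cross_cov_def)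
  let ?x = "\<lambda>\<omega>. X \<omega> $ j - mean_vec M n X $ j" and ?y = "\<lambda>\<omega>. Y \<omega> $ i - mean_vec M m Y $ i"
  have "mat_adjoint (cross_cov M n m X Y) $$ (i, j) = cnj (\<integral>\<omega>. ?x \<omega> * cnj (?y \<omega>) \<partial>M)"
    using ij by (simp add: cross_cov_def)
  also have "\<dots> = (\<integral>\<omega>. cnj (?x \<omega> * cnj (?y \<omega>)) \<partial>M)"
    by (rule Bochner_Integration.integral_cnj[symmetric])
  also have "\<dots> = cross_cov M m n Y X $$ (i, j)"
    using ij by (simp add: cross_cov_def mult.commute)
  finally show "mat_adjoint (cross_cov M n m X Y) $$ (i, j) = cross_cov M m n Y X $$ (i, j)" .
qed (simp_all add: cross_cov_def)

lemma integral_linear_combination_add: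
  fixes f g :: "_ \<Rightarrow> _ \<Rightarrow> complex"
  assumes "\<And>k. k \<in> I \<Longrightarrow> integrable M (f k)" "\<And>k. k \<in> J \<Longrightarrow> integrable M (g k)"
  shows "(\<integral>\<omega>. (\<Sum>k\<in>I. a k * f k \<omega>) + (\<Sum>k\<in>J. b k * g k \<omega>) \<partial>M)
    = (\<Sum>k\<in>I. a k * integral\<^sup>L M (f k)) + (\<Sum>k\<in>J. b k * integral\<^sup>L M (g k))"
proof -
  have "integrable M (\<lambda>\<omega>. a k * f k \<omega>)" if "k \<in> I" for k
    using assms(1)[OF that] by (rule integrable_mult_right)
  moreover have "integrable M (\<lambda>\<omega>. b k * g k \<omega>)" if "k \<in> J" for k
    using assms(2)[OF that] by (rule integrable_mult_right)
  ultimately show ?thesis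
    by (simp add: Bochner_Integration.integral_add Bochner_Integration.integral_sum
        Bochner_Integration.integrable_sum)
qed

text \<open>Means transform by the same matrices as the vectors, so the centred coordinates of
  \<open>Z\<close> are linear combinations of those of \<open>X\<close> and \<open>Y\<close>. Square
  integrability then allows the integral to be split.\<close>

lemma (in prob_space) cross_cov_affine_left:
  assumes A: "A \<in> carrier_mat n m" and B: "B \<in> carrier_mat n p"
    and X: "square_integrable_vec M m X" and Y: "square_integrable_vec M p Y"
    and T: "square_integrable_vec M q T"
    and Z: "\<And>\<omega>. \<omega> \<in> space M \<Longrightarrow> Z \<omega> = A *\<^sub>v X \<omega> + B *\<^sub>v Y \<omega>"
  shows "cross_cov M n q Z T = A * cross_cov M m q X T + B * cross_cov M p q Y T"
proof (rule eq_matI)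
  let ?R = "A * cross_cov M m q X T + B * cross_cov M p q Y T"
  fix i j assume "i < dim_row ?R" "j < dim_col ?R"
  then have i: "i < n" and j: "j < q" using B by (auto simp: cross_cov_def)
  have eq: "Z \<omega> $ i = (\<Sum>k<m. A $$ (i, k) * X \<omega> $ k) + (\<Sum>k<p. B $$ (i, k) * Y \<omega> $ k)"
    if "\<omega> \<in> space M" for \<omega>
    using X Y that i Z by (simp add: affine_index[OF A B] square_integrable_vec_def)
  have intX: "integrable M (\<lambda>\<omega>. X \<omega> $ k)" if "k < m" for k
    using square_integrable_vecD[OF X that] by (rule square_integrable_integrable)
  have intY: "integrable M (\<lambda>\<omega>. Y \<omega> $ k)" if "k < p" for k
    using square_integrable_vecD[OF Y that] by (rule square_integrable_integrable)
  define x where "x k \<omega> = X \<omega> $ k - mean_vec M m X $ k" for k \<omega>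
  define y where "y k \<omega> = Y \<omega> $ k - mean_vec M p Y $ k" for k \<omega>
  define t where "t \<omega> = T \<omega> $ j - mean_vec M q T $ j" for \<omega>
  have "mean_vec M n Z $ i = (\<integral>\<omega>. (\<Sum>k<m. A $$ (i, k) * X \<omega> $ k) + (\<Sum>k<p. B $$ (i, k) * Y \<omega> $ k) \<partial>M)"
    using i by (simp add: mean_vec_def eq cong: Bochner_Integration.integral_cong)
  also have "\<dots> = (\<Sum>k<m. A $$ (i, k) * mean_vec M m X $ k) + (\<Sum>k<p. B $$ (i, k) * mean_vec M p Y $ k)"
    by (subst integral_linear_combination_add) (auto simp: mean_vec_def intro: intX intY)
  finally have mean: "mean_vec M n Z $ i = \<dots>" .
  have centred: "Z \<omega> $ i - mean_vec M n Z $ i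
      = (\<Sum>k<m. A $$ (i, k) * x k \<omega>) + (\<Sum>k<p. B $$ (i, k) * y k \<omega>)" if "\<omega> \<in> space M" for \<omega>
    unfolding eq[OF that] mean x_def y_def
    by (simp add: sum_subtractf right_diff_distrib)
  have sqx: "square_integrable M (x k)" if "k < m" for k
    using square_integrable_diff_const[OF square_integrable_vecD[OF X that]] by (simp add: x_def[abs_def])
  have sqy: "square_integrable M (y k)" if "k < p" for k
    using square_integrable_diff_const[OF square_integrable_vecD[OF Y that]] by (simp add: y_def[abs_def])
  have sqt: "square_integrable M t"
    using square_integrable_diff_const[OF square_integrable_vecD[OF T j]] by (simp add: t_def[abs_def])
  have prod: "integrable M (\<lambda>\<omega>. x k \<omega> * cnj (t \<omega>))" if "k < m" for k
    using square_integrable_mult_cnj[OF sqx[OF that] sqt] .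
  have prod': "integrable M (\<lambda>\<omega>. y k \<omega> * cnj (t \<omega>))" if "k < p" for k
    using square_integrable_mult_cnj[OF sqy[OF that] sqt] .
  have "cross_cov M n q Z T $$ (i, j) = (\<integral>\<omega>. (Z \<omega> $ i - mean_vec M n Z $ i) * cnj (t \<omega>) \<partial>M)"
    using i j by (simp add: cross_cov_def t_def)
  also have "\<dots> = (\<integral>\<omega>. (\<Sum>k<m. A $$ (i, k) * (x k \<omega> * cnj (t \<omega>)))
      + (\<Sum>k<p. B $$ (i, k) * (y k \<omega> * cnj (t \<omega>))) \<partial>M)"
    by (rule Bochner_Integration.integral_cong)
      (simp_all add: centred distrib_right sum_distrib_right mult.assoc)
  also have "\<dots> = (\<Sum>k<m. A $$ (i, k) * (\<integral>\<omega>. x k \<omega> * cnj (t \<omega>) \<partial>M))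
      + (\<Sum>k<p. B $$ (i, k) * (\<integral>\<omega>. y k \<omega> * cnj (t \<omega>) \<partial>M))"
    using prod prod' by (intro integral_linear_combination_add) auto
  also have "\<dots> = ?R $$ (i, j)"
    using A B i j by (simp add: scalar_prod_def atLeast0LessThan cross_cov_def x_def y_def t_def)
  finally show "cross_cov M n q Z T $$ (i, j) = ?R $$ (i, j)" .
qed (use A B in \<open>auto simp: cross_cov_def\<close>)

text \<open>The covariance of \<open>\<Psi> 1\<close> is expanded in both arguments. Stationarity
  turns it and the covariance of \<open>\<Psi> 0\<close> into \<open>S\<close>, the control
  contributes \<open>G\<close>, and the mixed terms vanish because the initial state is uncorrelated
  with the control.\<close>

lemma stationary_covariance_lyapunov:
  assumes A: "A \<in> carrier_mat n n" and B: "B \<in> carrier_mat n p"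
    and stat: "stationary_covariance M A B G u \<Psi> S"
  shows "lyapunov_solution A B G S"
proof -
  interpret prob_space M using stat by (simp add: stationary_covariance_def)
  have X: "square_integrable_vec M n (\<Psi> 0)" and U: "square_integrable_vec M p (u 0)"
    and XU: "cross_cov M n p (\<Psi> 0) (u 0) = 0\<^sub>m n p" and UU: "cross_cov M p p (u 0) (u 0) = G"
    and step: "\<And>\<omega>. \<omega> \<in> space M \<Longrightarrow> \<Psi> 1 \<omega> = A *\<^sub>v \<Psi> 0 \<omega> + B *\<^sub>v u 0 \<omega>"
    and S: "\<And>l. cross_cov M n n (\<Psi> l) (\<Psi> l) = S"
    using stat A B by (auto simp: stationary_covariance_def white_controls_def)
  have Z: "square_integrable_vec M n (\<Psi> 1)"
    by (rule square_integrable_vec_affine[OF A B X U step])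
  note left = cross_cov_affine_left[OF A B X U _ step]
  have Sc: "S \<in> carrier_mat n n" and Gc: "G \<in> carrier_mat p p"
    using cross_cov_carrier S UU by metis+
  \<comment> \<open>Covariances are Hermitian; this simplifies the adjoints of \<open>A * S\<close>
    and \<open>B * G\<close> below.\<close>
  have SG': "mat_adjoint S = S" "mat_adjoint G = G"
    using mat_adjoint_cross_cov S UU by metis+
  have UX: "cross_cov M p n (u 0) (\<Psi> 0) = 0\<^sub>m p n"
    using mat_adjoint_cross_cov[of M n p "\<Psi> 0" "u 0"] XU by simp
  \<comment> \<open>Expanding in the first argument and taking adjoints gives the covariances with
    \<open>\<Psi> 1\<close> as second argument, which the final expansion of \<open>\<Psi> 1\<close>
    against itself consumes.\<close>
  have "cross_cov M n n (\<Psi> 1) (\<Psi> 0) = A * S"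
    using left[OF X] A B Sc S[of 0] UX by simp
  then have XZ: "cross_cov M n n (\<Psi> 0) (\<Psi> 1) = S * mat_adjoint A"
    using mat_adjoint_cross_cov[of M n n "\<Psi> 1" "\<Psi> 0"] mat_adjoint_mult[OF A Sc] SG' by simp
  have "cross_cov M n p (\<Psi> 1) (u 0) = B * G"
    using left[OF U] A B Gc UU XU by simp
  then have UZ: "cross_cov M p n (u 0) (\<Psi> 1) = G * mat_adjoint B"
    using mat_adjoint_cross_cov[of M n p "\<Psi> 1" "u 0"] mat_adjoint_mult[OF B Gc] SG' by simp
  have "S = A * (S * mat_adjoint A) + B * (G * mat_adjoint B)"
    using left[OF Z] S[of 1] XZ UZ by simp
  then show ?thesis
    using A B Sc Gc assoc_mult_mat[OF A Sc, of "mat_adjoint A" n]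
      assoc_mult_mat[OF B Gc, of "mat_adjoint B" n]
    by (simp add: lyapunov_solution_def)
qed

section \<open>Diagonalisation and the Lyapunov equation\<close>

text \<open>With \<open>V\<close> unitary, both \<open>A\<close> and its adjoint become diagonal in
  the same coordinates, and diagonal matrices commute.\<close>

lemma unitary_diagonalisation_normal:
  assumes A: "A \<in> carrier_mat n n" and V: "V \<in> carrier_mat n n"
    and unit: "mat_adjoint V * V = 1\<^sub>m n" and AV: "A * V = V * mat_diag n d"
  shows "normal_mat A"
proof -
  let ?V = "mat_adjoint V" and ?D = "mat_diag n d" and ?E = "mat_diag n (\<lambda>i. cnj (d i))"
  have V': "?V \<in> carrier_mat n n" using V by auto
  have unit': "V * ?V = 1\<^sub>m n"
    by (rule mat_mult_left_right_inverse[OF V' V unit])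
  note carr = A V V' mat_diag_dim[of n d] mat_diag_dim[of n "\<lambda>i. cnj (d i)"]
  note assoc = assoc_mult_mat[of _ n n _ n _ n] and mc = mult_carrier_mat[of _ n n _ n]
  have cancel: "?V * (V * X) = X" if "X \<in> carrier_mat n n" for X
    using assoc[OF V' V that] unit that by simp
  have "A = A * (V * ?V)" using unit' A by simp
  also have "\<dots> = V * (?D * ?V)" using assoc[OF A V V'] assoc[of V ?D ?V] carr AV by simp
  finally have A_eq: "A = V * (?D * ?V)" .
  have "mat_adjoint A = mat_adjoint (?D * ?V) * ?V"
    unfolding A_eq using carr by (intro mat_adjoint_mult[of _ n n _ n] mc)
  also have "\<dots> = V * (?E * ?V)"
    using carr mat_adjoint_mult[of ?D n n ?V n] by (simp add: mat_adjoint_mat_diag assoc mc)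
  finally have A'_eq: "mat_adjoint A = V * (?E * ?V)" .
  have prod: "V * (X * ?V) * (V * (Y * ?V)) = V * ((X * Y) * ?V)"
    if "X \<in> carrier_mat n n" "Y \<in> carrier_mat n n" for X Y
    using that carr by (simp add: assoc cancel mc)
  have "?D * ?E = ?E * ?D" by (simp add: mult.commute)
  then have "A * mat_adjoint A = mat_adjoint A * A"
    unfolding A'_eq unfolding A_eq by (simp add: prod del: mat_diag_diag)
  then show ?thesis using A by (auto simp: normal_mat_def)
qed

lemma mult_eigenvector_columns:
  fixes A :: "'a :: comm_ring_1 mat"
  assumes A: "A \<in> carrier_mat n n" and V: "V \<in> carrier_mat n m"
    and ev: "\<And>j. j < m \<Longrightarrow> eigenvector A (col V j) (d j)"
  shows "A * V = V * mat_diag m d"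
proof (rule eq_matI)
  fix i j assume ij: "i < dim_row (V * mat_diag m d)" "j < dim_col (V * mat_diag m d)"
  then have i: "i < n" and j: "j < m" using V by (auto simp: mat_diag_def)
  have "(A * V) $$ (i, j) = (A *\<^sub>v col V j) $ i" using A V i j by simp
  also have "\<dots> = d j * V $$ (i, j)" using ev[OF j] V i j by (simp add: eigenvector_def)
  also have "\<dots> = (V * mat_diag m d) $$ (i, j)"
    using V i j by (simp add: mat_diag_mult_right mult.commute)
  finally show "(A * V) $$ (i, j) = (V * mat_diag m d) $$ (i, j)" .
qed (use A V in \<open>auto simp: mat_diag_def\<close>)

text \<open>\<open>invertible_mat\<close> leaves the shape of the inverse implicit; it is recovered
  by comparing dimensions in the two inverse equations.\<close>

lemma invertible_matE:
  assumes "invertible_mat V" "V \<in> carrier_mat n n"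
  obtains W where "W \<in> carrier_mat n n" "V * W = 1\<^sub>m n" "W * V = 1\<^sub>m n"
proof -
  obtain W where W: "V * W = 1\<^sub>m n" "W * V = 1\<^sub>m (dim_row W)"
    using assms by (auto simp: invertible_mat_def inverts_mat_def)
  have "dim_col W = n" using arg_cong[OF W(1), of dim_col] by simp
  moreover have "dim_row W = n" using arg_cong[OF W(2), of dim_col] assms(2) by simp
  ultimately show ?thesis using that[of W] W by auto
qed

lemma similar_mat_diagI:
  fixes A :: "'a :: field mat"
  assumes A: "A \<in> carrier_mat n n" and V: "V \<in> carrier_mat n n" and W: "W \<in> carrier_mat n n"
    and VW: "V * W = 1\<^sub>m n" and AV: "A * V = V * mat_diag n d"
  shows "similar_mat A (mat_diag n d)"
proof -
  have WV: "W * V = 1\<^sub>m n"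
    by (rule mat_mult_left_right_inverse[OF V W VW])
  have "V * mat_diag n d * W = A"
    using assoc_mult_mat[OF A V W] VW A AV by simp
  then have "similar_mat_wit A (mat_diag n d) V W"
    using VW WV A V W by (intro similar_mat_witI) auto
  then show ?thesis unfolding similar_mat_def by blast
qed

section \<open>The spectrum of a matrix similar to a diagonal one\<close>

lemma char_poly_mat_diag:
  "char_poly (mat_diag n d) = (\<Prod>i<n. [:- d i, 1 :: 'a :: comm_ring_1:])"
proof -
  have "diag_mat (mat_diag n d) = map d [0..<n]"
    by (simp add: diag_mat_def mat_diag_def)
  moreover have "upper_triangular (mat_diag n d)"
    by (auto simp: mat_diag_def)
  ultimately have "char_poly (mat_diag n d) = (\<Prod>a\<leftarrow>map d [0..<n]. [:- a, 1:])"
    using char_poly_upper_triangular[OF mat_diag_dim] by metis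
  also have "\<dots> = (\<Prod>i<n. [:- d i, 1:])"
    by (simp add: prod.list_conv_set_nth[symmetric] comp_def prod.distinct_set_conv_list[symmetric]
      lessThan_atLeast0)
  finally show ?thesis .
qed

text \<open>Each diagonal entry is a root of the shared characteristic polynomial. Hypotheses on the
  spectrum thereby become statements about the \<open>d i\<close>.\<close>

lemma similar_mat_diag_spectrum:
  fixes A :: "'a :: field mat"
  assumes A: "A \<in> carrier_mat n n" and sim: "similar_mat A (mat_diag n d)" and i: "i < n"
  shows "d i \<in> spectrum A"
proof -
  have "poly (char_poly A) (d i) = 0"
    using i by (auto simp: char_poly_similar[OF sim] char_poly_mat_diag poly_prod intro!: prod_zero bexI[of _ i])
  then show ?thesis
    using eigenvalue_root_char_poly[OF A] by (simp add: spectrum_def)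
qed

text \<open>Two equal entries would put a squared linear factor into the characteristic polynomial,
  contradicting multiplicity one.\<close>

lemma simple_spectrum_inj_on:
  assumes A: "A \<in> carrier_mat n n" and sim: "similar_mat A (mat_diag n d)"
    and simple: "simple_spectrum A"
  shows "inj_on d {..<n}"
proof (rule inj_onI, rule ccontr)
  fix i j assume ij: "i \<in> {..<n}" "j \<in> {..<n}" "d i = d j" "i \<noteq> j"
  let ?q = "\<lambda>i. [:- d i, 1:]"
  have "char_poly A = (\<Prod>k<n. ?q k)"
    by (simp add: char_poly_similar[OF sim] char_poly_mat_diag)
  also have "\<dots> = ?q i * (?q j * (\<Prod>k\<in>{..<n} - {i} - {j}. ?q k))"
    using ij by (simp add: prod.remove[of "{..<n}" i] prod.remove[of "{..<n} - {i}" j])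
  finally have eq: "char_poly A = ?q i ^ 2 * (\<Prod>k\<in>{..<n} - {i} - {j}. ?q k)"
    by (simp only: power2_eq_square mult.assoc \<open>d i = d j\<close>)
  have "?q i ^ 2 dvd char_poly A" unfolding eq by simp
  moreover have "char_poly A \<noteq> 0"
    using degree_monic_char_poly[OF A] by auto
  ultimately have "2 \<le> Polynomial.order (d i) (char_poly A)"
    by (simp only: order_divides simp_thms)
  moreover have "Polynomial.order (d i) (char_poly A) = 1"
    using simple similar_mat_diag_spectrum[OF A sim, of i] ij by (auto simp: simple_spectrum_def)
  ultimately show False by simp
qed

section \<open>Uniqueness for the Lyapunov equation\<close>

lemma lyapunov_homogeneous_zero:
  assumes A: "A \<in> carrier_mat n n" and D: "D \<in> carrier_mat n n"
    and sim: "similar_mat_wit A (mat_diag n d) P Q"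
    and d: "\<And>i. i < n \<Longrightarrow> cmod (d i) < 1"
    and fix_eq: "D = A * D * mat_adjoint A"
  shows "D = 0\<^sub>m n n"
proof -
  let ?L = "mat_diag n d" and ?A = "mat_adjoint A" and ?Q = "mat_adjoint Q"
  note wit = similar_mat_witD2[OF A sim]
  have carr: "P \<in> carrier_mat n n" "Q \<in> carrier_mat n n" "?Q \<in> carrier_mat n n"
      "?A \<in> carrier_mat n n" "?L \<in> carrier_mat n n" "mat_adjoint ?L \<in> carrier_mat n n"
    using wit A by auto
  note assoc = assoc_mult_mat[of _ n n _ n _ n] and mc = mult_carrier_mat[of _ n n _ n]
  have cancel: "Q * (P * X) = X" "P * (Q * X) = X" if "X \<in> carrier_mat n n" for X
    using assoc[of Q P X] assoc[of P Q X] wit that by simp_all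
  have QA: "Q * A = ?L * Q"
    unfolding wit(3) using carr by (simp add: assoc cancel mc)
  have AQ: "?A * ?Q = ?Q * mat_adjoint ?L"
    using arg_cong[OF QA, of mat_adjoint] mat_adjoint_mult[of Q n n A n]
      mat_adjoint_mult[of ?L n n Q n] carr A by simp
  \<comment> \<open>A congruence rather than a similarity: the equation has \<open>A\<close> on the
    left and its adjoint on the right, and both become diagonal this way.\<close>
  define F where "F = Q * D * ?Q"
  have F: "F \<in> carrier_mat n n" using carr D by (auto simp: F_def)
  have "F = Q * (A * D * ?A) * ?Q" using fix_eq by (simp add: F_def)
  also have "\<dots> = (Q * A) * D * (?A * ?Q)" using carr A D by (simp add: assoc mc)
  also have "\<dots> = ?L * F * mat_adjoint ?L"
    unfolding QA AQ F_def using carr D by (simp add: assoc mc)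
  finally have F_eq: "F = ?L * F * mat_adjoint ?L" .
  have "F = 0\<^sub>m n n"
  proof (rule eq_matI)
    fix i j assume "i < dim_row (0\<^sub>m n n :: complex mat)" "j < dim_col (0\<^sub>m n n :: complex mat)"
    then have i: "i < n" and j: "j < n" by auto
    have "F $$ (i, j) = (?L * F * mat_adjoint ?L) $$ (i, j)" using F_eq by simp
    also have "\<dots> = d i * F $$ (i, j) * cnj (d j)"
      using i j F by (simp add: mat_adjoint_mat_diag mat_diag_mult_left[OF F]
          mat_diag_mult_right[of _ n n])
    finally have "(1 - d i * cnj (d j)) * F $$ (i, j) = 0" by (simp add: algebra_simps)
    moreover have "cmod (d i * cnj (d j)) < 1"
      using mult_strict_mono'[OF d[OF i] d[OF j]] by (simp add: norm_mult)
    then have "d i * cnj (d j) \<noteq> 1" by auto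
    ultimately have "F $$ (i, j) = 0" by simp
    then show "F $$ (i, j) = 0\<^sub>m n n $$ (i, j)" using i j by simp
  qed (use F in auto)
  have QP': "?Q * mat_adjoint P = 1\<^sub>m n"
  proof -
    have "mat_adjoint (1\<^sub>m n :: complex mat) = 1\<^sub>m n" by (rule eq_matI) auto
    then show ?thesis using arg_cong[OF wit(1), of mat_adjoint] mat_adjoint_mult[of P n n Q n] carr by simp
  qed
  \<comment> \<open>\<open>P\<close> is inverse to \<open>Q\<close>, so the congruence can be undone
    and the vanishing of \<open>F\<close> passes to \<open>D\<close>.\<close>
  have "D = P * F * mat_adjoint P"
    unfolding F_def using carr D QP' by (simp add: assoc cancel mc mat_adjoint_carrier[OF carr(1)])
  then show ?thesis using \<open>F = 0\<^sub>m n n\<close> carr by (simp add: mat_adjoint_carrier[OF carr(1)])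
qed

text \<open>The inhomogeneous term cancels in the difference of two solutions, leaving the
  homogeneous equation. The spectral radius bounds the modulus of every diagonal entry below
  one.\<close>

lemma lyapunov_solution_unique:
  assumes A: "A \<in> carrier_mat n n" and n: "0 < n" and rad: "spectral_radius A < 1"
    and diag: "diagonalisable A"
    and B: "B \<in> carrier_mat n p" and G: "G \<in> carrier_mat p p"
    and S: "lyapunov_solution A B G S" and T: "lyapunov_solution A B G T"
  shows "S = T"
proof -
  let ?A = "mat_adjoint A" and ?R = "B * G * mat_adjoint B"
  obtain L P Q where L: "diagonal_mat L" "similar_mat_wit A L P Q"
    using diag by (auto simp: diagonalisable_def similar_mat_def)
  define d where "d i = L $$ (i, i)" for i
  have "L = mat_diag n d"
    using L similar_mat_witD2[OF A L(2)] by (intro eq_matI) (auto simp: mat_diag_def diagonal_mat_def d_def)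
  with L have sim: "similar_mat_wit A (mat_diag n d) P Q" by simp
  have d: "cmod (d i) < 1" if "i < n" for i
  proof -
    have "similar_mat A (mat_diag n d)" using sim by (auto simp: similar_mat_def)
    then show ?thesis
      using spectral_radius_mem_max(2)[OF A n imageI[OF similar_mat_diag_spectrum[OF A _ that]]] rad
      by fastforce
  qed
  have carr: "S \<in> carrier_mat n n" "T \<in> carrier_mat n n" "?A \<in> carrier_mat n n"
    "?R \<in> carrier_mat n n"
    using S T A B G by (auto simp: lyapunov_solution_def)
  have eqs: "S = A * S * ?A + ?R" "T = A * T * ?A + ?R"
    using S T by (auto simp: lyapunov_solution_def)
  have "A * (S - T) * ?A = A * S * ?A - A * T * ?A"
    using carr A by (simp add: mult_minus_distrib_mat[of A n n] minus_mult_distrib_mat[of "A * S" n n "A * T" ?A n]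
        mult_carrier_mat[of _ n n _ n])
  also have "\<dots> = (A * S * ?A + ?R) - (A * T * ?A + ?R)"
    using carr A B by (intro eq_matI) auto
  also have "\<dots> = S - T" using eqs by simp
  finally have zero: "S - T = 0\<^sub>m n n"
    using carr A sim d by (intro lyapunov_homogeneous_zero[of A n _ d P Q]) auto
  have "S $$ (i, j) - T $$ (i, j) = 0" if "i < n" "j < n" for i j
    using arg_cong[OF zero, of "\<lambda>M. M $$ (i, j)"] that carr by simp
  then show ?thesis using carr by (intro eq_matI) auto
qed

section \<open>Normality and the condition number\<close>

text \<open>With distinct eigenvalues, normality makes the columns of \<open>V\<close> eigenvectors
  of the adjoint as well. Evaluating the Gram matrix against the adjoint in two ways then shows that
  the columns are orthogonal.\<close>

lemma normal_eigenvectors_unitary: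
  assumes A: "A \<in> carrier_mat n n" and V: "V \<in> carrier_mat n n" and W: "W \<in> carrier_mat n n"
    and VW: "V * W = 1\<^sub>m n" and AV: "A * V = V * mat_diag n d"
    and inj: "inj_on d {..<n}" and unit: "\<And>j. j < n \<Longrightarrow> vec_norm2 (col V j) = 1"
    and normal: "normal_mat A"
  shows "mat_adjoint V * V = 1\<^sub>m n"
proof -
  let ?A = "mat_adjoint A" and ?V = "mat_adjoint V" and ?D = "mat_diag n d"
  note assoc = assoc_mult_mat[of _ n n _ n _ n] and mc = mult_carrier_mat[of _ n n _ n]
  have WV: "W * V = 1\<^sub>m n" by (rule mat_mult_left_right_inverse[OF V W VW])
  have A': "?A \<in> carrier_mat n n" and V': "?V \<in> carrier_mat n n" using A V by auto
  note carr = A V W A' V' mat_diag_dim[of n d]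
  have cancel: "V * (W * X) = X" "W * (V * X) = X" if "X \<in> carrier_mat n n" for X
    using assoc[OF V W that] assoc[OF W V that] VW WV that by simp_all
  have comm: "A * ?A = ?A * A" using normal by (simp add: normal_mat_def)
  \<comment> \<open>\<open>A\<^sup>*\<close> commutes with \<open>A\<close>, so in the coordinates \<open>V\<close> it commutes with the diagonal matrix
    of distinct entries and is itself diagonal.\<close>
  define M where "M = W * ?A * V"
  have M: "M \<in> carrier_mat n n" using carr by (simp add: M_def mc)
  have A'V: "?A * V = V * M" using carr by (simp add: M_def assoc cancel mc)
  have "?D = W * A * V" using carr AV by (simp add: assoc cancel mc)
  then have "?D * M = W * (A * ?A) * V" using carr by (simp add: M_def assoc cancel mc)
  also have "\<dots> = W * ?A * (A * V)" unfolding comm using carr by (simp add: assoc mc)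
  also have "\<dots> = M * ?D" unfolding AV using carr by (simp add: M_def assoc mc)
  finally have DM: "?D * M = M * ?D" .
  have offdiag: "M $$ (i, j) = 0" if "i < n" "j < n" "i \<noteq> j" for i j
  proof -
    have "d i * M $$ (i, j) = M $$ (i, j) * d j"
      using arg_cong[OF DM, of "\<lambda>X. X $$ (i, j)"] that
      by (simp add: mat_diag_mult_left[OF M] mat_diag_mult_right[OF M])
    moreover have "d i \<noteq> d j" using inj that by (auto dest: inj_onD)
    ultimately show ?thesis by auto
  qed
  have M_diag: "M = mat_diag n (\<lambda>j. M $$ (j, j))"
    using M offdiag by (intro eq_matI) (auto simp: mat_diag_def)
  \<comment> \<open>The Gram matrix of the eigenvectors, to be shown equal to the identity; the unit
    columns settle its diagonal.\<close>
  define H where "H = ?V * V"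
  have H: "H \<in> carrier_mat n n" using carr by (simp add: H_def mc)
  have H_diag: "H $$ (j, j) = 1" if "j < n" for j
    using that unit mat_adjoint_mult_self_index[OF V that that] by (simp add: H_def cscalar_prod_self)
  have "mat_diag n (\<lambda>i. cnj (d i)) * H = mat_adjoint (V * ?D) * V"
    using carr mat_adjoint_mult[OF V mat_diag_dim[of n d]]
      assoc[OF mat_diag_dim V' V, of "\<lambda>i. cnj (d i)"]
    by (simp add: H_def mat_adjoint_mat_diag)
  also have "\<dots> = ?V * (?A * V)"
    unfolding AV[symmetric] using carr mat_adjoint_mult[OF A V] by (simp add: assoc)
  also have "\<dots> = H * M" unfolding A'V H_def using carr M by (simp add: assoc)
  finally have DH: "mat_diag n (\<lambda>i. cnj (d i)) * H = H * M" .
  have entry: "cnj (d i) * H $$ (i, j) = H $$ (i, j) * M $$ (j, j)" if "i < n" "j < n" for i j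
    using arg_cong[OF DH, of "\<lambda>X. X $$ (i, j)"] that
    by (subst (asm) M_diag) (simp add: mat_diag_mult_left[OF H] mat_diag_mult_right[OF H])
  have "H $$ (i, j) = 0" if "i < n" "j < n" "i \<noteq> j" for i j
  proof -
    have "(d i - d j) \<noteq> 0" using inj that by (auto dest: inj_onD)
    \<comment> \<open>The diagonal case of \<open>entry\<close>, where \<open>H\<close> has entry 1,
      identifies \<open>M $$ (j, j)\<close> as \<open>cnj (d j)\<close>. Substituting this in the
      case \<open>(i, j)\<close> gives the equation.\<close>
    moreover have "cnj (d i - d j) * H $$ (i, j) = 0"
      using entry[OF that(1,2)] entry[OF that(2,2)] H_diag[OF that(2)] by (simp add: algebra_simps)
    ultimately show ?thesis by (metis complex_cnj_zero_iff mult_eq_0_iff)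
  qed
  then have "H = 1\<^sub>m n" using H H_diag by (intro eq_matI) auto
  then show ?thesis by (simp add: H_def)
qed

text \<open>Inverses are unique, so a known inverse can replace \<open>the (mat_inverse V)\<close>
  in \<open>cond2\<close>.\<close>

lemma mat_inverse_eqI:
  fixes V :: "'a :: field mat"
  assumes V: "V \<in> carrier_mat n n" and W: "W \<in> carrier_mat n n" and WV: "W * V = 1\<^sub>m n"
  shows "mat_inverse V = Some W"
proof -
  have VW: "V * W = 1\<^sub>m n" by (rule mat_mult_left_right_inverse[OF W V WV])
  \<comment> \<open>\<open>mat_inverse\<close> returns \<open>None\<close> only outside the units of
    the matrix ring.\<close>
  have "V \<in> Units (ring_mat TYPE('a) n ())"
    using V W VW WV by (auto simp: Units_def ring_mat_def)
  then obtain X where X: "mat_inverse V = Some X"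
    using mat_inverse(1)[OF V, where b = "()"] by (cases "mat_inverse V") auto
  note inv = mat_inverse(2)[OF V X]
  have "X = W * V * X" using inv WV left_mult_one_mat[of X n n] by simp
  also have "\<dots> = W" using inv W assoc_mult_mat[OF W V, of X n] by simp
  finally show ?thesis using X by simp
qed

text \<open>A unitary matrix and its adjoint are isometries, so both norms are one. Conversely, the
  norm bounds for \<open>V\<close> and its inverse, whose constants multiply to one, squeeze
  \<open>vec_norm2 (V *\<^sub>v x)\<close> to a fixed multiple of
  \<open>vec_norm2 x\<close>.\<close>

lemma cond2_eq_1_iff_unitary:
  assumes V: "V \<in> carrier_mat n n" and inv: "invertible_mat V" and n: "0 < n"
    and unit: "\<And>j. j < n \<Longrightarrow> vec_norm2 (col V j) = 1"
  shows "cond2 V = 1 \<longleftrightarrow> mat_adjoint V * V = 1\<^sub>m n"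
proof
  assume unitary: "mat_adjoint V * V = 1\<^sub>m n"
  have V': "mat_adjoint V \<in> carrier_mat n n" using V by auto
  have "mat_inverse V = Some (mat_adjoint V)"
    by (rule mat_inverse_eqI[OF V V' unitary])
  moreover have "mat_norm2 V = 1"
    using vec_norm2_isometry[OF V unitary] by (intro mat_norm2_isometry[OF V n])
  moreover have "mat_norm2 (mat_adjoint V) = 1"
    using vec_norm2_isometry[OF V'] mat_mult_left_right_inverse[OF V' V unitary]
    by (intro mat_norm2_isometry[OF V' n]) auto
  ultimately show "cond2 V = 1" by (simp add: cond2_def)
next
  assume cond: "cond2 V = 1"
  obtain W where W: "W \<in> carrier_mat n n" "V * W = 1\<^sub>m n" "W * V = 1\<^sub>m n"
    using invertible_matE[OF inv V] .
  have ab: "mat_norm2 V * mat_norm2 W = 1"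
    using cond mat_inverse_eqI[OF V W(1,3)] by (simp add: cond2_def)
  \<comment> \<open>The image is the first column, of norm one. The resulting lower bound makes
    \<open>mat_norm2 V\<close> nonnegative, so that inequalities may be multiplied by it.\<close>
  have "vec_norm2 (V *\<^sub>v unit_vec n 0) \<le> mat_norm2 V"
    using vec_norm2_mult_mat_vec_le[of "unit_vec n 0" V] V n by auto
  then have ge1: "1 \<le> mat_norm2 V"
    using unit[OF n] by (simp add: mult_mat_unit_vec[OF V n])
  have scaled: "vec_norm2 (V *\<^sub>v x) = mat_norm2 V * vec_norm2 x" if x: "x \<in> carrier_vec n" for x
  proof (rule antisym)
    show "vec_norm2 (V *\<^sub>v x) \<le> mat_norm2 V * vec_norm2 x"
      using vec_norm2_mult_mat_vec_le V x by auto
    have "W *\<^sub>v (V *\<^sub>v x) = x"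
      using assoc_mult_mat_vec[OF W(1) V x] W(3) x by simp
    then have "vec_norm2 x \<le> mat_norm2 W * vec_norm2 (V *\<^sub>v x)"
      using vec_norm2_mult_mat_vec_le[of "V *\<^sub>v x" W] mult_mat_vec_carrier[OF V x] W(1) by auto
    then have "mat_norm2 V * vec_norm2 x \<le> mat_norm2 V * (mat_norm2 W * vec_norm2 (V *\<^sub>v x))"
      using ge1 by (intro mult_left_mono) auto
    then show "mat_norm2 V * vec_norm2 x \<le> vec_norm2 (V *\<^sub>v x)"
      using ab by (simp add: mult.assoc[symmetric])
  qed
  \<comment> \<open>Evaluating the scaling law at the first unit vector compares the factor with the
    norm of the first column.\<close>
  have "mat_norm2 V = 1"
    using scaled[of "unit_vec n 0"] unit[OF n] n by (simp add: mult_mat_unit_vec[OF V n])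
  then show "mat_adjoint V * V = 1\<^sub>m n"
    using scaled by (intro isometry_unitary[OF V]) simp
qed

text \<open>Both sides are equivalent to \<open>V\<close> being unitary; the simple spectrum
  supplies the distinct eigenvalues for the direction from normality.\<close>

lemma normal_iff_cond2_eq_1:
  assumes A: "A \<in> carrier_mat n n" and n: "0 < n" and simple: "simple_spectrum A"
    and V: "unit_eigenvector_matrix A V"
  shows "normal_mat A \<longleftrightarrow> cond2 V = 1"
proof -
  have carr: "V \<in> carrier_mat n n" and inv: "invertible_mat V"
    and unit: "\<And>j. j < n \<Longrightarrow> vec_norm2 (col V j) = 1"
    and ev: "\<forall>j<n. \<exists>\<mu>. eigenvector A (col V j) \<mu>"
    using V A by (auto simp: unit_eigenvector_matrix_def)
  from ev obtain d where "\<And>j. j < n \<Longrightarrow> eigenvector A (col V j) (d j)" by metis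
  then have AV: "A * V = V * mat_diag n d" by (rule mult_eigenvector_columns[OF A carr])
  obtain W where W: "W \<in> carrier_mat n n" "V * W = 1\<^sub>m n"
    using invertible_matE[OF inv carr] .
  have inj: "inj_on d {..<n}"
    using similar_mat_diagI[OF A carr W AV] simple by (rule simple_spectrum_inj_on[OF A])
  have "normal_mat A \<longleftrightarrow> mat_adjoint V * V = 1\<^sub>m n"
    using normal_eigenvectors_unitary[OF A carr W AV inj] unit
      unitary_diagonalisation_normal[OF A carr _ AV] by blast
  also have "\<dots> \<longleftrightarrow> cond2 V = 1"
    using cond2_eq_1_iff_unitary[OF carr inv n] unit by blast
  finally show ?thesis .
qed

text \<open>Taken as columns, the common eigenvectors form a unitary matrix that diagonalises
  \<open>A\<close>.\<close>

lemma orthonormal_eigenbasis_normal: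
  assumes A: "A \<in> carrier_mat n n" and S: "S \<in> carrier_mat n n"
    and vs: "orthonormal_eigenbasis S vs" and ev: "\<forall>v\<in>set vs. \<exists>\<mu>. eigenvector A v \<mu>"
  shows "normal_mat A"
proof -
  have len: "length vs = n"
    and orth: "\<And>i j. i < n \<Longrightarrow> j < n \<Longrightarrow> vs ! i \<bullet>c vs ! j = (if i = j then 1 else 0)"
    using vs S by (auto simp: orthonormal_eigenbasis_def)
  have sub: "set vs \<subseteq> carrier_vec n"
    using ev A by (auto simp: eigenvector_def)
  define V where "V = mat_of_cols n vs"
  have V: "V \<in> carrier_mat n n" using len by (auto simp: V_def)
  have col: "col V j = vs ! j" if "j < n" for j
    using that len sub by (simp add: V_def subsetD)
  have "\<forall>j<n. \<exists>\<mu>. eigenvector A (col V j) \<mu>" using ev col len by simp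
  then obtain d where "\<And>j. j < n \<Longrightarrow> eigenvector A (col V j) (d j)" by metis
  then have "A * V = V * mat_diag n d" by (rule mult_eigenvector_columns[OF A V])
  moreover have "mat_adjoint V * V = 1\<^sub>m n"
  proof (rule eq_matI)
    fix i j assume ij: "i < dim_row (1\<^sub>m n :: complex mat)" "j < dim_col (1\<^sub>m n :: complex mat)"
    then have "(mat_adjoint V * V) $$ (i, j) = vs ! j \<bullet>c vs ! i"
      using mat_adjoint_mult_self_index[OF V, of i j] by (simp add: col)
    then show "(mat_adjoint V * V) $$ (i, j) = 1\<^sub>m n $$ (i, j)"
      using ij orth by auto
  qed (use V in auto)
  ultimately show ?thesis by (intro unitary_diagonalisation_normal[OF A V])
qed

theorem theorem8p1:
  fixes A B Gu \<Sigma> :: "complex mat" and N p :: nat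
  assumes "0 < N"
    and "A \<in> carrier_mat N N"
    and "B \<in> carrier_mat N p"
    and "Gu \<in> carrier_mat p p"
    and "spectral_radius A < 1"
    and "diagonalisable A"
    and "simple_spectrum A"
    and "pos_semidef_mat Gu"
    and "lyapunov_solution A B Gu \<Sigma>"
    and "pos_def_mat \<Sigma>"
  shows "(\<forall>S. lyapunov_solution A B Gu S \<longrightarrow> S = \<Sigma>) \<and>
    (\<forall>(M :: 'w measure) u \<Psi> S. stationary_covariance M A B Gu u \<Psi> S \<longrightarrow> S = \<Sigma>) \<and>
    ((\<exists>vs. orthonormal_eigenbasis \<Sigma> vs \<and> (\<forall>v \<in> set vs. \<exists>\<mu>. eigenvector A v \<mu>)) \<longrightarrow>
       normal_mat A) \<and>
    (\<forall>V. unit_eigenvector_matrix A V \<longrightarrow> (normal_mat A \<longleftrightarrow> cond2 V = 1))"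
proof (intro conjI allI impI)
  \<comment> \<open>One of the two solutions is fixed to be \<open>\<Sigma>\<close>; the open
    premise receives either an arbitrary solution or a stationary covariance.\<close>
  note uniq = lyapunov_solution_unique[OF assms(2,1,5,6,3,4) _ assms(9)]
  show "S = \<Sigma>" if "lyapunov_solution A B Gu S" for S
    using that by (rule uniq)
  show "S = \<Sigma>" if "stationary_covariance M A B Gu u \<Psi> S"
    for M :: "'w measure" and u \<Psi> S
    using stationary_covariance_lyapunov[OF assms(2,3) that] by (rule uniq)
  have S: "\<Sigma> \<in> carrier_mat N N"
    using assms(2,9) by (simp add: lyapunov_solution_def)
  show "normal_mat A"
    if "\<exists>vs. orthonormal_eigenbasis \<Sigma> vs \<and> (\<forall>v\<in>set vs. \<exists>\<mu>. eigenvector A v \<mu>)"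
    using that orthonormal_eigenbasis_normal[OF assms(2) S] by blast
  show "normal_mat A \<longleftrightarrow> cond2 V = 1" if "unit_eigenvector_matrix A V" for V
    using that by (rule normal_iff_cond2_eq_1[OF assms(2,1,7)])
qed

end
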